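(* Let $p$ be a prime, let $d\ge 2$, and let $G=G_{p,d}=C_p\wr X$ be the restricted wreath product, where $C_p=\langle a\rangle$ has order $p$ and $X=\langle x_1,\dots,x_d\rangle$ is free abelian of rank $d$. Let $G'$ be the commutator subgroup of $G$, and let $H=G'Y$ where $Y=\langle x_1^{p},x_2,\dots,x_d\rangle$. Then the map $$f:\ a^{x_1^{i}-1}\mapsto a^{i}\ \ (1\le i\le p-1),\qquad a^{z-1}\mapsto e\ \text{ for all } z\in Y,$$ $$x_1^{p}\mapsto x_2,\qquad x_j\mapsto x_{1+j}\ \ (2\le j\le d-1),\qquad x_d\mapsto x_1$$ extends to a simple homomorphism $f:H\to G_{p,d}$.
   Context: The restricted wreath product $C_p\wr X$ is the semidirect product $A\rtimes X$, where $A=\bigoplus_{w\in X}\langle a^w\rangle$ and $a^w=w^{-1}aw$. For $r=\sum_{w\in X} c_w w$ in the group algebra $GF(p)[X]$, write $a^{r}=\prod_w (a^w)^{c_w}$; thus $a^{w-1}=a^w a^{-1}$. A subgroup $K\le H$ is $f$-invariant if $K^f\le K$. The homomorphism $f:H\to G$ (with $H$ of finite index in $G$) is simple if the only subgroup $K\le H$ that is normal in $G$ and $f$-invariant is the trivial one. *)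

theory Defs
  imports
    "HOL-Computational_Algebra.Primes"
    "HOL-Algebra.Generated_Groups"
    "HOL-Algebra.Product_Groups"
    "HOL-Algebra.Elementary_Groups"
    "HOL-Algebra.Free_Abelian_Groups"
begin

text \<open>
  The pair \<open>(b, w)\<close> stands for the product \<open>b w\<close>, and \<open>\<phi> w\<close> is the automorphism
  \<open>b \<mapsto> w b w\<^sup>-\<^sup>1\<close> of the normal factor.
\<close>
definition semidirect_product ::
  "('a, 'm) monoid_scheme \<Rightarrow> ('b, 'n) monoid_scheme \<Rightarrow> ('b \<Rightarrow> 'a \<Rightarrow> 'a) \<Rightarrow> ('a \<times> 'b) monoid"
  where "semidirect_product A X \<phi> =
    \<lparr>carrier = carrier A \<times> carrier X,
     monoid.mult = (\<lambda>(b, w) (c, v). (b \<otimes>\<^bsub>A\<^esub> \<phi> w c, w \<otimes>\<^bsub>X\<^esub> v)),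
     one = (\<one>\<^bsub>A\<^esub>, \<one>\<^bsub>X\<^esub>)\<rparr>"

text \<open>
  An element \<open>b\<close> of the base group is the function whose value at \<open>w\<close> is the component of \<open>b\<close> in
  the summand \<open>C\<^sup>w = w\<^sup>-\<^sup>1 C w\<close>. Since \<open>u C\<^sup>w u\<^sup>-\<^sup>1\<close> is the summand at \<open>w u\<^sup>-\<^sup>1\<close>, the component of
  \<open>u b u\<^sup>-\<^sup>1\<close> at \<open>w\<close> is the component of \<open>b\<close> at \<open>w u\<close>.
\<close>
definition restricted_wreath_product ::
  "('a, 'm) monoid_scheme \<Rightarrow> ('b, 'n) monoid_scheme \<Rightarrow> (('b \<Rightarrow> 'a) \<times> 'b) monoid"
  where "restricted_wreath_product C X =
    semidirect_product (sum_group (carrier X) (\<lambda>_. C)) X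
      (\<lambda>u b. \<lambda>w\<in>carrier X. b (w \<otimes>\<^bsub>X\<^esub> u))"

definition wreath_base ::
  "('a, 'm) monoid_scheme \<Rightarrow> ('b, 'n) monoid_scheme \<Rightarrow> 'a \<Rightarrow> ('b \<Rightarrow> 'a) \<times> 'b"
  where "wreath_base C X c =
    ((\<lambda>w\<in>carrier X. if w = \<one>\<^bsub>X\<^esub> then c else \<one>\<^bsub>C\<^esub>), \<one>\<^bsub>X\<^esub>)"

definition wreath_top ::
  "('a, 'm) monoid_scheme \<Rightarrow> ('b, 'n) monoid_scheme \<Rightarrow> 'b \<Rightarrow> ('b \<Rightarrow> 'a) \<times> 'b"
  where "wreath_top C X w = ((\<lambda>v\<in>carrier X. \<one>\<^bsub>C\<^esub>), w)"

type_synonym lamplighter = "((nat \<Rightarrow>\<^sub>0 int) \<Rightarrow> int) \<times> (nat \<Rightarrow>\<^sub>0 int)"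

definition lamplighter_group :: "nat \<Rightarrow> nat \<Rightarrow> lamplighter monoid"
  where "lamplighter_group p d =
    restricted_wreath_product (integer_mod_group p) (free_Abelian_group {1..d})"

definition gen_a :: "nat \<Rightarrow> nat \<Rightarrow> lamplighter"
  where "gen_a p d = wreath_base (integer_mod_group p) (free_Abelian_group {1..d}) 1"

definition gen_x :: "nat \<Rightarrow> nat \<Rightarrow> nat \<Rightarrow> lamplighter"
  where "gen_x p d j = wreath_top (integer_mod_group p) (free_Abelian_group {1..d}) (frag_of j)"

definition subgroup_Y :: "nat \<Rightarrow> nat \<Rightarrow> lamplighter set"
  where "subgroup_Y p d =
    generate (lamplighter_group p d)
      (insert (gen_x p d 1 [^]\<^bsub>lamplighter_group p d\<^esub> p) (gen_x p d ` {2..d}))"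

definition subgroup_H :: "nat \<Rightarrow> nat \<Rightarrow> lamplighter set"
  where "subgroup_H p d =
    derived (lamplighter_group p d) (carrier (lamplighter_group p d))
      <#>\<^bsub>lamplighter_group p d\<^esub> subgroup_Y p d"

text \<open>The element written \<open>g\<^bsup>w-1\<^esup> = g\<^sup>w g\<^sup>-\<^sup>1\<close>, where \<open>g\<^sup>w = w\<^sup>-\<^sup>1 g w\<close>.\<close>
definition pow_minus_one :: "('a, 'm) monoid_scheme \<Rightarrow> 'a \<Rightarrow> 'a \<Rightarrow> 'a"
  where "pow_minus_one G g w = (inv\<^bsub>G\<^esub> w \<otimes>\<^bsub>G\<^esub> g \<otimes>\<^bsub>G\<^esub> w) \<otimes>\<^bsub>G\<^esub> inv\<^bsub>G\<^esub> g"

definition virtual_endomorphism ::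
  "('a, 'm) monoid_scheme \<Rightarrow> 'a set \<Rightarrow> ('a \<Rightarrow> 'a) \<Rightarrow> bool"
  where "virtual_endomorphism G H f \<longleftrightarrow>
    subgroup H G \<and> finite (rcosets\<^bsub>G\<^esub> H) \<and> f \<in> hom (G\<lparr>carrier := H\<rparr>) G"

definition simple_virtual_endomorphism ::
  "('a, 'm) monoid_scheme \<Rightarrow> 'a set \<Rightarrow> ('a \<Rightarrow> 'a) \<Rightarrow> bool"
  where "simple_virtual_endomorphism G H f \<longleftrightarrow>
    virtual_endomorphism G H f \<and>
    (\<forall>K. K \<lhd> G \<and> K \<subseteq> H \<and> f ` K \<subseteq> K \<longrightarrow> K = {\<one>\<^bsub>G\<^esub>})"

lemma group_semidirect_product:
  assumes A: "group A" and X: "group X"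
    and hom: "\<And>w. w \<in> carrier X \<Longrightarrow> \<phi> w \<in> hom A A"
    and one: "\<And>b. b \<in> carrier A \<Longrightarrow> \<phi> \<one>\<^bsub>X\<^esub> b = b"
    and mult: "\<And>b w v. \<lbrakk>b \<in> carrier A; w \<in> carrier X; v \<in> carrier X\<rbrakk>
                 \<Longrightarrow> \<phi> (w \<otimes>\<^bsub>X\<^esub> v) b = \<phi> w (\<phi> v b)"
  shows "group (semidirect_product A X \<phi>)"
proof -
  interpret A: group A by fact
  interpret X: group X by fact
  have closed: "\<phi> w b \<in> carrier A" if "w \<in> carrier X" "b \<in> carrier A" for w b
    using hom[OF that(1)] that(2) by (auto simp: hom_def)
  have dist: "\<phi> w (b \<otimes>\<^bsub>A\<^esub> c) = \<phi> w b \<otimes>\<^bsub>A\<^esub> \<phi> w c"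
    if "w \<in> carrier X" "b \<in> carrier A" "c \<in> carrier A" for w b c
    using hom[OF that(1)] that(2,3) by (auto simp: hom_def)
  have phi_one: "\<phi> w \<one>\<^bsub>A\<^esub> = \<one>\<^bsub>A\<^esub>" if "w \<in> carrier X" for w
    using hom_one[OF hom[OF that] A A] .
  show ?thesis
  proof (rule groupI)
    fix g assume "g \<in> carrier (semidirect_product A X \<phi>)"
    then obtain b w where g: "g = (b, w)" "b \<in> carrier A" "w \<in> carrier X"
      by (auto simp: semidirect_product_def)
    let ?h = "(\<phi> (inv\<^bsub>X\<^esub> w) (inv\<^bsub>A\<^esub> b), inv\<^bsub>X\<^esub> w)"
    have "?h \<in> carrier (semidirect_product A X \<phi>)"
      using g by (simp add: semidirect_product_def closed)
    moreover have "?h \<otimes>\<^bsub>semidirect_product A X \<phi>\<^esub> g = \<one>\<^bsub>semidirect_product A X \<phi>\<^esub>"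
      using g by (simp add: semidirect_product_def dist[symmetric] phi_one)
    ultimately show "\<exists>h\<in>carrier (semidirect_product A X \<phi>).
        h \<otimes>\<^bsub>semidirect_product A X \<phi>\<^esub> g = \<one>\<^bsub>semidirect_product A X \<phi>\<^esub>" by blast
  qed (auto simp: semidirect_product_def closed dist one mult A.m_assoc X.m_assoc)
qed

lemma group_restricted_wreath_product:
  assumes C: "group C" and X: "group X"
  shows "group (restricted_wreath_product C X)"
  unfolding restricted_wreath_product_def
proof (rule group_semidirect_product)
  interpret C: group C by fact
  interpret X: group X by fact
  let ?A = "sum_group (carrier X) (\<lambda>_. C)"
  let ?\<phi> = "\<lambda>u b. \<lambda>w\<in>carrier X. b (w \<otimes>\<^bsub>X\<^esub> u)"
  note carr = carrier_sum_group[of "carrier X" "\<lambda>_. C", OF C]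
  show "group ?A" using C by simp
  show "group X" by fact
  show "?\<phi> u \<in> hom ?A ?A" if u: "u \<in> carrier X" for u
  proof (rule homI)
    fix b assume b: "b \<in> carrier ?A"
    have "{w \<in> carrier X. b (w \<otimes>\<^bsub>X\<^esub> u) \<noteq> \<one>\<^bsub>C\<^esub>}
        \<subseteq> (\<lambda>w. w \<otimes>\<^bsub>X\<^esub> inv\<^bsub>X\<^esub> u) ` {w \<in> carrier X. b w \<noteq> \<one>\<^bsub>C\<^esub>}"
    proof
      fix w assume "w \<in> {w \<in> carrier X. b (w \<otimes>\<^bsub>X\<^esub> u) \<noteq> \<one>\<^bsub>C\<^esub>}"
      then show "w \<in> (\<lambda>w. w \<otimes>\<^bsub>X\<^esub> inv\<^bsub>X\<^esub> u) ` {w \<in> carrier X. b w \<noteq> \<one>\<^bsub>C\<^esub>}"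
        using u by (intro image_eqI[of _ _ "w \<otimes>\<^bsub>X\<^esub> u"]) (auto simp: X.m_assoc)
    qed
    moreover have "finite {w \<in> carrier X. b w \<noteq> \<one>\<^bsub>C\<^esub>}"
      using b by (simp add: carr)
    ultimately have "finite {w \<in> carrier X. b (w \<otimes>\<^bsub>X\<^esub> u) \<noteq> \<one>\<^bsub>C\<^esub>}"
      by (meson finite_imageI finite_subset)
    then show "?\<phi> u b \<in> carrier ?A"
      using b u by (auto simp: carr PiE_iff cong: conj_cong)
  qed (use u in \<open>auto simp: fun_eq_iff restrict_def\<close>)
  show "?\<phi> \<one>\<^bsub>X\<^esub> b = b" if "b \<in> carrier ?A" for b
    using that by (auto simp: carr fun_eq_iff restrict_def PiE_iff extensional_def)
  show "?\<phi> (w \<otimes>\<^bsub>X\<^esub> v) b = ?\<phi> w (?\<phi> v b)"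
    if "b \<in> carrier ?A" "w \<in> carrier X" "v \<in> carrier X" for b w v
    using that by (auto simp: fun_eq_iff restrict_def X.m_assoc)
qed

lemma group_lamplighter_group: "group (lamplighter_group p d)"
  by (simp add: lamplighter_group_def group_restricted_wreath_product)

end

theory Submission
  imports Defs "HOL-Number_Theory.Cong"
begin

text \<open>
  \<open>G'\<close> is the augmentation ideal of \<open>GF(p)[X]\<close>. Writing \<open>r = \<Sum>\<^sub>i x\<^sub>1\<^sup>i r\<^sub>i\<close> with \<open>r\<^sub>i \<in> GF(p)[Y]\<close> and \<open>\<sigma>\<close> for
  the isomorphism \<open>Y \<rightarrow> X\<close>, the map \<open>F r = \<Sum>\<^sub>i i \<sigma>(r\<^sub>i)\<close> satisfies \<open>F (z r) = \<sigma>(z) F r\<close> for \<open>z \<in> Y\<close>, so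
  \<open>(r, z) \<mapsto> (F r, \<sigma> z)\<close> is a homomorphism.

  For simplicity, a nontrivial invariant normal subgroup contains a commutator with \<open>a\<close> and hence meets
  the base group in a nonzero ideal \<open>J\<close> of \<open>GF(p)[X]\<close>, inside the augmentation ideal, with \<open>F J \<subseteq> J\<close>.
  Consider the functionals \<open>r \<mapsto> \<Sum>\<^sub>v r\<^sub>v \<Prod>\<^sub>j (v\<^sub>j choose e\<^sub>j)\<close> on the polynomials in \<open>J\<close>. The one with \<open>e = 0\<close>
  vanishes. If the one for \<open>e\<close> vanishes, so do those for smaller exponents, by Pascal's rule and
  multiplication by the \<open>x\<^sub>j\<close>; composing it with \<open>F\<close> gives, by Lucas' congruence
  \<open>(pn + i) choose (pm + 1) \<equiv> i (n choose m)\<close>, the one for \<open>(p e\<^sub>2 + 1, e\<^sub>3, \<dots>, e\<^sub>d, e\<^sub>1)\<close>. Hence all of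
  them vanish, and they separate polynomials.
\<close>

section \<open>Binomial coefficients modulo a prime\<close>

text \<open>Coefficient comparison in (1+x)^(n+p) = (1+x)^n (1+x^p) modulo p.\<close>

lemma choose_add_prime_cong:
  fixes p :: nat
  assumes "prime p"
  shows "[(n + p) choose (k + p) = (n choose (k + p)) + (n choose k)] (mod p)"
proof -
  have p0: "p \<noteq> 0" using assms by auto
  let ?g = "\<lambda>i. (p choose i) * (n choose (k + p - i))"
  have "(n + p) choose (k + p) = (\<Sum>i\<le>k + p. ?g i)"
    by (simp add: vandermonde add.commute)
  \<comment> \<open>For 0 < i < p the prime divides \<open>p choose i\<close>, and for i > p this
    coefficient is 0, so only the two end terms survive.\<close>
  also have "[\<dots> = (\<Sum>i\<le>k + p. if i \<in> {0, p} then ?g i else 0)] (mod p)"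
  proof (rule cong_sum)
    fix i assume "i \<in> {..k + p}"
    show "[?g i = (if i \<in> {0, p} then ?g i else 0)] (mod p)"
    proof (cases "i \<in> {0, p} \<or> i > p")
      case False
      then have "p dvd p choose i"
        using assms by (intro dvd_choose_prime) auto
      then show ?thesis
        using False by (simp add: cong_0_iff)
    qed (auto simp: binomial_eq_0)
  qed
  also have "(\<Sum>i\<le>k + p. if i \<in> {0, p} then ?g i else 0) = sum ?g {0, p}"
    by (subst sum.inter_restrict[symmetric]) (auto intro!: sum.cong)
  also have "\<dots> = (n choose (k + p)) + (n choose k)"
    using p0 by simp
  finally show ?thesis .
qed

text \<open>Lucas' congruence for the last digits r and 1: the factor r is
  \<open>r choose 1\<close>. The induction on n applies Pascal's rule in steps of p.\<close>

lemma choose_prime_mult_Suc_cong: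
  fixes p :: nat
  assumes "prime p" and "r < p"
  shows "[(p * n + r) choose Suc (p * m) = r * (n choose m)] (mod p)"
proof (induction n arbitrary: m)
  case 0
  show ?case
    using assms(2) by (cases m) (auto simp: binomial_eq_0)
next
  case (Suc n)
  show ?case
  proof (cases m)
    case 0
    then show ?thesis by (simp add: cong_def add.assoc)
  next
    case (Suc m')
    have "[(p * n + r + p) choose (Suc (p * m') + p)
        = ((p * n + r) choose Suc (p * m)) + ((p * n + r) choose Suc (p * m'))] (mod p)"
      using choose_add_prime_cong[OF assms(1), of "p * n + r" "Suc (p * m')"] Suc
      by (simp add: add_ac)
    also have "[((p * n + r) choose Suc (p * m)) + ((p * n + r) choose Suc (p * m'))
        = r * (n choose m) + r * (n choose m')] (mod p)"
      by (intro cong_add Suc.IH)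
    finally show ?thesis
      using Suc by (simp add: algebra_simps)
  qed
qed

text \<open>By \<open>lower\<close>, Q passes to smaller vectors. A rotation moves every entry one
  place cyclically and raises the one that arrives at position 1, since p m + 1 >= m + 1. After d
  rotations of a constant vector each entry has been raised, so Q holds for all constant vectors,
  and every vector lies below one of them on {1..d}.\<close>

lemma exponents_exhausted:
  fixes Q :: "(nat \<Rightarrow> nat) \<Rightarrow> bool"
  assumes d: "d \<ge> 2" and p: "p > 0"
    and zero: "Q (\<lambda>_. 0)"
    and local: "\<And>e e'. \<lbrakk>Q e; \<And>j. j \<in> {1..d} \<Longrightarrow> e' j = e j\<rbrakk> \<Longrightarrow> Q e'"
    and lower: "\<And>e k. \<lbrakk>Q (e(k := Suc (e k))); k \<in> {1..d}\<rbrakk> \<Longrightarrow> Q e"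
    and rotate: "\<And>e. Q e \<Longrightarrow> Q (\<lambda>j. if j = 1 then Suc (p * e 2) else if j = d then e 1 else e (Suc j))"
  shows "Q e"
proof -
  have lower': "Q (e(k := m))" if "Q e" "k \<in> {1..d}" "m \<le> e k" for e k m
    using that(3)
  proof (induction rule: inc_induct)
    case base
    then show ?case using that by simp
  next
    case (step n)
    have "Q ((e(k := n))(k := Suc ((e(k := n)) k)))"
      using step.IH by (simp only: fun_upd_upd fun_upd_same)
    then show ?case using that(2) by (rule lower)
  qed
  have down: "Q e'" if Q: "Q e" and le: "\<And>j. j \<in> {1..d} \<Longrightarrow> e' j \<le> e j" for e e'
  proof -
    have "Q (\<lambda>j. if j \<in> F then e' j else e j)" if "F \<subseteq> {1..d}" for F
      using finite_subset[OF that finite_atLeastAtMost] that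
    proof (induction F)
      case (insert k F)
      have "Q ((\<lambda>j. if j \<in> F then e' j else e j)(k := e' k))"
        using insert le by (intro lower') auto
      also have "((\<lambda>j. if j \<in> F then e' j else e j)(k := e' k))
          = (\<lambda>j. if j \<in> insert k F then e' j else e j)"
        by auto
      finally show ?case .
    qed (use Q in simp)
    from this[of "{1..d}"] show ?thesis
      by (rule local) auto
  qed
  \<comment> \<open>For 1 <= k <= d, \<open>?c n k\<close> is a lower bound after k rotations of the
    constant n: position 1 and the last k - 1 positions have been raised. For k = d these are all
    positions.\<close>
  let ?c = "\<lambda>n k j. n + of_bool (j = 1 \<or> j + k \<ge> d + 2) :: nat"
  have const: "Q (\<lambda>_. n)" for n
  proof (induction n)
    case (Suc n)
    have "Q (?c n (Suc k))" if "k < d" for k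
      using that
    proof (induction k)
      case 0
      have "Suc (p * n) \<ge> Suc n"
        using p by simp
      then show ?case
        using d by (intro down[OF rotate[OF Suc]]) auto
    next
      case (Suc k)
      have "Suc (p * m) \<ge> Suc m" for m
        using p by simp
      then show ?case
        using d Suc.prems Suc.IH by (intro down[OF rotate[OF Suc.IH]]) (auto simp: le_Suc_eq)
    qed
    from this[of "d - 1"] d have "Q (?c n d)" by simp
    then show ?case
      by (rule down) auto
  qed (use zero in simp)
  show ?thesis
    by (rule down[OF const[of "\<Sum>j\<in>{1..d}. e j"]]) (simp add: member_le_sum)
qed

section \<open>Coordinates on the wreath product\<close>

text \<open>The group X in additive notation: exponent vectors of the Laurent monomials in x_1, ...,
  x_d.\<close>

definition exponents :: "nat \<Rightarrow> (nat \<Rightarrow>\<^sub>0 int) set"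
  where "exponents d = {w. Poly_Mapping.keys w \<subseteq> {1..d}}"

lemma exponents_closed [simp, intro]:
  "0 \<in> exponents d"
  "\<lbrakk>v \<in> exponents d; w \<in> exponents d\<rbrakk> \<Longrightarrow> v + w \<in> exponents d"
  "\<lbrakk>v \<in> exponents d; w \<in> exponents d\<rbrakk> \<Longrightarrow> v - w \<in> exponents d"
  "w \<in> exponents d \<Longrightarrow> - w \<in> exponents d"
  "w \<in> exponents d \<Longrightarrow> frag_cmul k w \<in> exponents d"
  "j \<in> {1..d} \<Longrightarrow> frag_of j \<in> exponents d"
  unfolding exponents_def mem_Collect_eq
  using keys_add[of v w] keys_diff[of v w] keys_cmul[of k w]
  by (blast | simp)+

lemma exponents_eqI:
  assumes "v \<in> exponents d" "w \<in> exponents d"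
    and "\<And>j. j \<in> {1..d} \<Longrightarrow> poly_mapping.lookup v j = poly_mapping.lookup w j"
  shows "v = w"
proof (rule poly_mapping_eqI)
  fix j
  show "poly_mapping.lookup v j = poly_mapping.lookup w j"
    using assms unfolding exponents_def by (cases "j \<in> {1..d}") (simp, metis in_keys_iff mem_Collect_eq subsetD)
qed

locale lamplighter =
  fixes p d :: nat
  assumes prime_p: "prime p" and d_ge_2: "d \<ge> 2"
begin

abbreviation "G \<equiv> lamplighter_group p d"
abbreviation "L \<equiv> exponents d"

text \<open>The base group as GF(p)[X], with least nonnegative residues as coefficients. The
  monomial w is \<open>delta w\<close>, which is the conjugate of a by w.\<close>

definition base :: "((nat \<Rightarrow>\<^sub>0 int) \<Rightarrow> int) set"
  where "base = {b \<in> L \<rightarrow>\<^sub>E {0..<int p}. finite {w \<in> L. b w \<noteq> 0}}"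

definition zeroB :: "(nat \<Rightarrow>\<^sub>0 int) \<Rightarrow> int"
  where "zeroB = (\<lambda>w\<in>L. 0)"

definition delta :: "(nat \<Rightarrow>\<^sub>0 int) \<Rightarrow> (nat \<Rightarrow>\<^sub>0 int) \<Rightarrow> int"
  where "delta v = (\<lambda>w\<in>L. of_bool (w = v))"

definition addB :: "((nat \<Rightarrow>\<^sub>0 int) \<Rightarrow> int) \<Rightarrow> ((nat \<Rightarrow>\<^sub>0 int) \<Rightarrow> int) \<Rightarrow> (nat \<Rightarrow>\<^sub>0 int) \<Rightarrow> int"
  where "addB b c = (\<lambda>w\<in>L. (b w + c w) mod int p)"

definition negB :: "((nat \<Rightarrow>\<^sub>0 int) \<Rightarrow> int) \<Rightarrow> (nat \<Rightarrow>\<^sub>0 int) \<Rightarrow> int"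
  where "negB b = (\<lambda>w\<in>L. (- b w) mod int p)"

text \<open>On GF(p)[X] this is multiplication by the inverse of the monomial u; in the group it is
  b \<mapsto> u b u^-1.\<close>

definition shift :: "(nat \<Rightarrow>\<^sub>0 int) \<Rightarrow> ((nat \<Rightarrow>\<^sub>0 int) \<Rightarrow> int) \<Rightarrow> (nat \<Rightarrow>\<^sub>0 int) \<Rightarrow> int"
  where "shift u b = (\<lambda>w\<in>L. b (w + u))"

lemma p_gt_1: "int p > 1" and p_gt_0: "int p > 0"
  using prime_gt_1_nat[OF prime_p] by simp_all

lemma carrier_X: "carrier (free_Abelian_group {1..d}) = L"
  "carrier (free_Abelian_group {Suc 0..d}) = L"
  by (simp_all add: exponents_def free_Abelian_group_def)

lemma carrier_G: "carrier G = base \<times> L"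
proof -
  have "carrier (sum_group L (\<lambda>_. integer_mod_group p)) = base"
    using p_gt_0 by (subst carrier_sum_group) (simp_all add: carrier_integer_mod_group base_def)
  then show ?thesis
    unfolding lamplighter_group_def restricted_wreath_product_def semidirect_product_def
    by (simp only: carrier_X partial_object.simps)
qed

lemma mult_G: "(b, w) \<otimes>\<^bsub>G\<^esub> (c, v) = (addB b (shift w c), w + v)"
  unfolding lamplighter_group_def restricted_wreath_product_def semidirect_product_def
  by (simp add: addB_def shift_def fun_eq_iff restrict_def flip: carrier_X(1))

lemma one_G: "\<one>\<^bsub>G\<^esub> = (zeroB, 0)"
  unfolding lamplighter_group_def restricted_wreath_product_def semidirect_product_def
  by (simp add: carrier_X zeroB_def)

sublocale G: group G
  by (rule group_lamplighter_group)

lemma base_eqI: "\<lbrakk>b \<in> base; c \<in> base; \<And>w. w \<in> L \<Longrightarrow> b w = c w\<rbrakk> \<Longrightarrow> b = c"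
  unfolding base_def by (auto intro: PiE_ext)

lemma base_range: "\<lbrakk>b \<in> base; w \<in> L\<rbrakk> \<Longrightarrow> b w \<in> {0..<int p}"
  unfolding base_def by blast

lemma base_mod: "\<lbrakk>b \<in> base; w \<in> L\<rbrakk> \<Longrightarrow> b w mod int p = b w"
  using base_range by fastforce

lemma base_finite: "b \<in> base \<Longrightarrow> finite {w \<in> L. b w \<noteq> 0}"
  unfolding base_def by blast

lemma baseI:
  assumes "finite S" and "\<And>w. \<lbrakk>w \<in> L; w \<notin> S\<rbrakk> \<Longrightarrow> b w = 0"
    and "\<And>w. w \<in> L \<Longrightarrow> b w \<in> {0..<int p}" and "b \<in> extensional L"
  shows "b \<in> base"
  unfolding base_def using assms by (auto simp: PiE_iff intro: finite_subset[of _ S])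

lemma zero_base [simp, intro]: "zeroB \<in> base"
  using p_gt_0 by (auto simp: zeroB_def intro!: baseI[of "{}"])

lemma delta_base [simp, intro]: "delta v \<in> base"
  using p_gt_1 by (intro baseI[of "{v}"]) (auto simp: delta_def)

lemma add_base [simp, intro]: "\<lbrakk>b \<in> base; c \<in> base\<rbrakk> \<Longrightarrow> addB b c \<in> base"
  using p_gt_0
  by (intro baseI[of "{w \<in> L. b w \<noteq> 0} \<union> {w \<in> L. c w \<noteq> 0}"]) (auto simp: addB_def base_finite)

lemma neg_base [simp, intro]: "b \<in> base \<Longrightarrow> negB b \<in> base"
  using p_gt_0 by (intro baseI[of "{w \<in> L. b w \<noteq> 0}"]) (auto simp: negB_def base_finite)

lemma shift_base [simp, intro]:
  assumes "b \<in> base" "u \<in> L"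
  shows "shift u b \<in> base"
proof (rule baseI)
  show "finite ((\<lambda>w. w - u) ` {w \<in> L. b w \<noteq> 0})"
    using assms by (intro finite_imageI base_finite)
  show "shift u b w = 0" if "w \<in> L" "w \<notin> (\<lambda>w. w - u) ` {w \<in> L. b w \<noteq> 0}" for w
    using that assms image_eqI[of w "\<lambda>w. w - u" "w + u"] by (auto simp: shift_def)
qed (use assms base_range in \<open>auto simp: shift_def\<close>)

lemma shift_0 [simp]: "b \<in> base \<Longrightarrow> shift 0 b = b"
  by (rule base_eqI, simp_all) (simp add: shift_def)

lemma shift_zero [simp]: "u \<in> L \<Longrightarrow> shift u zeroB = zeroB"
  by (auto simp: shift_def zeroB_def fun_eq_iff)

lemma add_zero [simp]: "b \<in> base \<Longrightarrow> addB b zeroB = b" "b \<in> base \<Longrightarrow> addB zeroB b = b"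
  by (rule base_eqI, simp_all, simp add: addB_def zeroB_def base_mod)+

lemma add_neg [simp]: "addB b (negB b) = zeroB" "addB (negB b) b = zeroB"
  by (auto simp: fun_eq_iff addB_def zeroB_def negB_def mod_simps)

lemma shift_delta: "\<lbrakk>u \<in> L; v \<in> L\<rbrakk> \<Longrightarrow> shift u (delta v) = delta (v - u)"
  by (auto simp: shift_def delta_def fun_eq_iff)

lemma inv_base: "b \<in> base \<Longrightarrow> inv\<^bsub>G\<^esub> (b, 0) = (negB b, 0)"
  by (rule G.inv_equality) (auto simp: mult_G one_G carrier_G)

lemma inv_top: "w \<in> L \<Longrightarrow> inv\<^bsub>G\<^esub> (zeroB, w) = (zeroB, - w)"
  by (rule G.inv_equality) (auto simp: mult_G one_G carrier_G)

lemma gen_a_eq: "gen_a p d = (delta 0, 0)"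
  by (auto simp: gen_a_def wreath_base_def carrier_X delta_def fun_eq_iff)

lemma gen_x_eq: "gen_x p d j = (zeroB, frag_of j)"
  by (simp add: gen_x_def wreath_top_def carrier_X zeroB_def)

lemma top_hom: "(\<lambda>w. (zeroB, w)) \<in> hom (free_Abelian_group {1..d}) G"
  by (rule homI) (use carrier_X in \<open>auto simp: mult_G carrier_G exponents_def\<close>)

lemma top_pow: "w \<in> L \<Longrightarrow> (zeroB, w) [^]\<^bsub>G\<^esub> (n::nat) = (zeroB, frag_cmul (int n) w)"
  using hom_nat_pow[OF top_hom] by (simp add: carrier_X)

lemma top_int_pow: "w \<in> L \<Longrightarrow> (zeroB, w) [^]\<^bsub>G\<^esub> (n::int) = (zeroB, frag_cmul n w)"
  using group_hom.hom_int_pow[OF group_hom.intro, OF group_free_Abelian_group G.is_group,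
      unfolded group_hom_axioms_def, OF top_hom, of w n] carrier_X
  by (auto simp: exponents_def)

lemma base_pow:
  assumes "b \<in> base"
  shows "(b, 0) [^]\<^bsub>G\<^esub> (n::nat) = ((\<lambda>w\<in>L. (int n * b w) mod int p), 0)"
proof (induction n)
  case 0
  show ?case by (simp add: one_G zeroB_def restrict_def)
next
  case (Suc n)
  then show ?case
    using assms
    by (auto simp: mult_G addB_def fun_eq_iff mod_simps distrib_right add.commute)
qed

lemma conj_top_base:
  assumes "u \<in> L" "b \<in> base"
  shows "(zeroB, u) \<otimes>\<^bsub>G\<^esub> (b, 0) \<otimes>\<^bsub>G\<^esub> inv\<^bsub>G\<^esub> (zeroB, u) = (shift u b, 0)"
  using assms by (simp add: inv_top mult_G)

lemma pow_minus_one_top: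
  assumes "w \<in> L"
  shows "pow_minus_one G (gen_a p d) (zeroB, w) = (addB (delta w) (negB (delta 0)), 0)"
  using assms by (simp add: pow_minus_one_def gen_a_eq inv_top inv_base mult_G shift_delta)

section \<open>Linear functionals on GF(p)[X] given by integer weights on the monomials\<close>

definition pair :: "((nat \<Rightarrow>\<^sub>0 int) \<Rightarrow> int) \<Rightarrow> ((nat \<Rightarrow>\<^sub>0 int) \<Rightarrow> int) \<Rightarrow> int"
  where "pair \<phi> b = (\<Sum>w | w \<in> L \<and> b w \<noteq> 0. \<phi> w * b w)"

lemma pair_eq_sum:
  assumes "finite S" "S \<subseteq> L" "\<And>w. \<lbrakk>w \<in> L; w \<notin> S\<rbrakk> \<Longrightarrow> b w = 0"
  shows "pair \<phi> b = (\<Sum>w\<in>S. \<phi> w * b w)"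
  unfolding pair_def using assms by (intro sum.mono_neutral_left) auto

text \<open>Only a congruence, because \<open>addB\<close> reduces the coefficients while
  \<open>pair\<close> sums integers.\<close>

lemma pair_add:
  assumes "b \<in> base" "c \<in> base"
  shows "[pair \<phi> (addB b c) = pair \<phi> b + pair \<phi> c] (mod int p)"
proof -
  let ?S = "{w \<in> L. b w \<noteq> 0} \<union> {w \<in> L. c w \<noteq> 0}"
  have S: "finite ?S" using assms base_finite by blast
  have "pair \<phi> (addB b c) = (\<Sum>w\<in>?S. \<phi> w * addB b c w)"
    using S by (intro pair_eq_sum) (auto simp: addB_def)
  also have "[\<dots> = (\<Sum>w\<in>?S. \<phi> w * b w + \<phi> w * c w)] (mod int p)"
    by (intro cong_sum) (auto simp: addB_def cong_def mod_simps simp flip: distrib_left)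
  also have "(\<Sum>w\<in>?S. \<phi> w * b w + \<phi> w * c w) = pair \<phi> b + pair \<phi> c"
    using S by (subst (1 2) pair_eq_sum[of ?S]) (auto simp: sum.distrib)
  finally show ?thesis .
qed

lemma pair_shift:
  assumes "b \<in> base" "u \<in> L"
  shows "pair \<phi> (shift u b) = pair (\<lambda>w. \<phi> (w - u)) b"
proof -
  have "bij_betw (\<lambda>w. w + u) {w. w \<in> L \<and> shift u b w \<noteq> 0} {w. w \<in> L \<and> b w \<noteq> 0}"
    by (rule bij_betwI[of _ _ _ "\<lambda>w. w - u"]) (use assms in \<open>auto simp: shift_def\<close>)
  from sum.reindex_bij_betw[OF this, of "\<lambda>w. \<phi> (w - u) * b w"] show ?thesis
    unfolding pair_def by (simp add: shift_def)
qed

lemma pair_zero [simp]: "pair \<phi> zeroB = 0"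
  by (simp add: pair_def zeroB_def)

text \<open>The augmentation of the base component together with the exponent of x_1, both modulo p.
  The kernel will be H, which gives at once that H is a subgroup of finite index.\<close>

definition char :: "lamplighter \<Rightarrow> int \<times> int"
  where "char = (\<lambda>(b, w). (pair (\<lambda>_. 1) b mod int p, poly_mapping.lookup w 1 mod int p))"

abbreviation "ZpZp \<equiv> integer_mod_group p \<times>\<times> integer_mod_group p"

lemma char_hom: "char \<in> hom G ZpZp"
proof (rule homI)
  show "char g \<in> carrier ZpZp" if "g \<in> carrier G" for g
    using p_gt_0 by (auto simp: char_def carrier_integer_mod_group split: prod.splits)
  fix g h assume "g \<in> carrier G" "h \<in> carrier G"
  then obtain b w c v where g: "g = (b, w)" "b \<in> base" "w \<in> L"
    and h: "h = (c, v)" "c \<in> base" "v \<in> L" by (auto simp: carrier_G)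
  have "[pair (\<lambda>_. 1) (addB b (shift w c)) = pair (\<lambda>_. 1) b + pair (\<lambda>_. 1) c] (mod int p)"
    using g h pair_add[of b "shift w c" "\<lambda>_. 1"] by (simp add: pair_shift)
  then show "char (g \<otimes>\<^bsub>G\<^esub> h) = char g \<otimes>\<^bsub>ZpZp\<^esub> char h"
    using g h by (simp add: char_def mult_G lookup_add cong_def mod_simps)
qed

end

section \<open>The domain as a kernel\<close>

context lamplighter
begin

interpretation char: group_hom G ZpZp char
  by (intro group_hom.intro group_hom_axioms.intro char_hom G.is_group DirProd_group) auto

abbreviation "ker_char \<equiv> kernel G ZpZp char"

abbreviation "commutators \<equiv> derived G (carrier G)"

lemma gen_a_pow:
  "gen_a p d [^]\<^bsub>G\<^esub> (k::nat) = ((\<lambda>w\<in>L. if w = 0 then int k mod int p else 0), 0)"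
  by (subst gen_a_eq, subst base_pow[OF delta_base]) (auto simp: delta_def fun_eq_iff)

lemma mem_ker_char:
  "(b, w) \<in> ker_char \<longleftrightarrow> b \<in> base \<and> w \<in> L \<and> int p dvd pair (\<lambda>_. 1) b \<and> int p dvd poly_mapping.lookup w 1"
  by (auto simp: kernel_def char_def carrier_G dvd_eq_mod_eq_0)

lemma derived_subset_ker_char: "commutators \<subseteq> ker_char"
proof -
  interpret Z: comm_group ZpZp
    by (rule group.group_comm_groupI[OF char.H.is_group]) (auto simp: add.commute)
  have "char ` commutators = {\<one>\<^bsub>ZpZp\<^esub>}"
    using char.derived_img[of "carrier G"] Z.derived_eq_singleton char.hom_closed
    by (simp add: image_subset_iff)
  then show ?thesis
    using G.derived_in_carrier[of "carrier G"] by (auto simp: kernel_def)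
qed

text \<open>The right-hand side is a subgroup containing the generators. Conversely, a vector
  supported in a finite set F is reduced to the zero vector by splitting off one coordinate at a
  time.\<close>

lemma subgroup_Y_eq:
  "subgroup_Y p d = {(zeroB, w) | w. w \<in> L \<and> int p dvd poly_mapping.lookup w 1}" (is "_ = ?Y")
proof
  have one: "(1::nat) \<in> {1..d}" using d_ge_2 by auto
  have gens: "insert (gen_x p d 1 [^]\<^bsub>G\<^esub> p) (gen_x p d ` {2..d}) \<subseteq> ?Y"
    using one by (auto simp: gen_x_eq top_pow)
  have "subgroup ?Y G"
  proof (rule G.subgroupI)
    show "?Y \<noteq> {}" by (auto intro!: exI[of _ 0])
  qed (auto simp: carrier_G inv_top mult_G lookup_add)
  with gens show "subgroup_Y p d \<subseteq> ?Y"
    unfolding subgroup_Y_def by (rule G.generate_subgroup_incl)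
  have Y: "subgroup (subgroup_Y p d) G"
    unfolding subgroup_Y_def using one
    by (intro G.generate_is_subgroup) (auto simp: gen_x_eq top_pow carrier_G)
  have "(zeroB, w) \<in> subgroup_Y p d"
    if "finite F" "F \<subseteq> {1..d}" "Poly_Mapping.keys w \<subseteq> F" "int p dvd poly_mapping.lookup w 1" for F w
    using that
  proof (induction F arbitrary: w)
    case empty
    then show ?case using subgroup.one_closed[OF Y] by (simp add: one_G)
  next
    case (insert j F)
    define k where "k = poly_mapping.lookup w j"
    define v where "v = w - frag_cmul k (frag_of j)"
    have j: "j \<in> {1..d}" using insert by auto
    have w: "w \<in> L" using insert by (auto simp: exponents_def)
    have vL: "v \<in> L" using w j by (simp add: v_def)
    have "Poly_Mapping.keys v \<subseteq> F"
    proof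
      fix i assume "i \<in> Poly_Mapping.keys v"
      then have "poly_mapping.lookup v i \<noteq> 0" by (simp add: in_keys_iff)
      then have "i \<noteq> j" "poly_mapping.lookup w i \<noteq> 0"
        by (auto simp: v_def k_def lookup_minus split: if_splits)
      then show "i \<in> F" using insert.prems(2) by (auto simp: in_keys_iff)
    qed
    moreover have "int p dvd poly_mapping.lookup v 1"
      using insert.prems(3) by (auto simp: v_def k_def lookup_minus)
    ultimately have v: "(zeroB, v) \<in> subgroup_Y p d"
      using insert.IH insert.prems by auto
    have "(zeroB, frag_cmul k (frag_of j)) \<in> subgroup_Y p d"
    proof (cases "j = 1")
      \<comment> \<open>Here k is divisible by p, so x_1^k is the (k/p)-th power of the generator
        x_1^p.\<close>
      case True
      have "gen_x p d 1 [^]\<^bsub>G\<^esub> p \<in> subgroup_Y p d"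
        unfolding subgroup_Y_def by (rule generate.incl) simp
      then have "(zeroB, frag_cmul (int p) (frag_of 1)) \<in> subgroup_Y p d"
        using one by (simp add: gen_x_eq top_pow)
      from G.subgroup_int_pow_closed[OF Y this, of "k div int p"] show ?thesis
        using True one insert.prems(3) by (simp add: top_int_pow k_def)
    next
      case False
      then have "gen_x p d j \<in> subgroup_Y p d"
        using j unfolding subgroup_Y_def by (intro generate.incl) auto
      from G.subgroup_int_pow_closed[OF Y this, of k] show ?thesis
        using j by (simp add: top_int_pow gen_x_eq)
    qed
    from subgroup.m_closed[OF Y v this] show ?case
      using vL by (simp add: mult_G v_def)
  qed
  from this[OF finite_atLeastAtMost order_refl] show "?Y \<subseteq> subgroup_Y p d"
    by (auto simp: exponents_def)
qed

text \<open>Modulo G' all conjugates of a coincide, so an element of the base group is congruent to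
  a power of a. The induction removes one monomial of the support at a time.\<close>

lemma base_in_derived_coset:
  assumes "finite F" "b \<in> base" "\<And>w. \<lbrakk>w \<in> L; w \<notin> F\<rbrakk> \<Longrightarrow> b w = 0"
  shows "\<exists>k::nat. (b, 0) \<in> commutators #>\<^bsub>G\<^esub> (gen_a p d [^]\<^bsub>G\<^esub> k)"
  using assms
proof (induction F arbitrary: b)
  case empty
  interpret D: normal commutators G by (rule G.derived_self_is_normal)
  have "b = zeroB" using empty by (intro base_eqI zero_base) (simp_all add: zeroB_def)
  then have "(b, 0) \<in> commutators #>\<^bsub>G\<^esub> (gen_a p d [^]\<^bsub>G\<^esub> (0::nat))"
    using D.one_closed D.subset by (simp add: one_G[symmetric])
  then show ?case by blast
next
  case (insert v F)
  interpret D: normal commutators G by (rule G.derived_self_is_normal)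
  let ?a = "gen_a p d"
  have aG: "?a \<in> carrier G" by (simp add: gen_a_eq carrier_G)
  show ?case
  proof (cases "v \<in> L")
    case False
    then show ?thesis using insert.IH[OF insert.prems(1)] insert.prems(2) by blast
  next
    case v: True
    define b1 where "b1 = (\<lambda>w\<in>L. if w = v then 0 else b w)"
    define b2 where "b2 = (\<lambda>w\<in>L. if w = v then b v else 0)"
    define k2 where "k2 = nat (b v)"
    have bv: "0 \<le> b v" "b v < int p" using base_range[OF insert.prems(1) v] by auto
    have b1: "b1 \<in> base"
      using p_gt_0 base_range[OF insert.prems(1)]
      by (intro baseI[OF base_finite[OF insert.prems(1)]]) (auto simp: b1_def)
    have "b1 w = 0" if "w \<in> L" "w \<notin> F" for w
      using insert.prems(2) that by (auto simp: b1_def)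
    from insert.IH[OF b1 this] obtain k1 :: nat
      where k1: "(b1, 0) \<in> commutators #>\<^bsub>G\<^esub> (?a [^]\<^bsub>G\<^esub> k1)"
      by blast
    \<comment> \<open>Conjugation by u on the left moves the coefficient at 0 to -u; hence the sign,
      which puts it at v.\<close>
    define x where "x = (zeroB, - v)"
    have x: "x \<in> carrier G" using v by (simp add: x_def carrier_G)
    have h: "?a [^]\<^bsub>G\<^esub> k2 \<in> carrier G" using aG by simp
    have a_pow: "?a [^]\<^bsub>G\<^esub> k2 = ((\<lambda>w\<in>L. if w = 0 then b v else 0), 0)"
      using bv by (auto simp: gen_a_pow k2_def fun_eq_iff)
    have "x \<otimes>\<^bsub>G\<^esub> ?a [^]\<^bsub>G\<^esub> k2 \<otimes>\<^bsub>G\<^esub> inv\<^bsub>G\<^esub> x = (b2, 0)"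
    proof -
      have "(\<lambda>w\<in>L. if w = 0 then b v else 0) \<in> base"
        using h by (simp add: a_pow carrier_G)
      then show ?thesis
        using v unfolding x_def a_pow
        by (subst conj_top_base) (auto simp: shift_def b2_def fun_eq_iff)
    qed
    moreover have "x \<otimes>\<^bsub>G\<^esub> ?a [^]\<^bsub>G\<^esub> k2 \<otimes>\<^bsub>G\<^esub> inv\<^bsub>G\<^esub> x \<otimes>\<^bsub>G\<^esub> inv\<^bsub>G\<^esub> (?a [^]\<^bsub>G\<^esub> k2) \<in> commutators"
      unfolding derived_def using x h by (intro generate.incl) blast
    ultimately have "(b2, 0) \<otimes>\<^bsub>G\<^esub> inv\<^bsub>G\<^esub> (?a [^]\<^bsub>G\<^esub> k2) \<in> commutators" by simp
    moreover have b2G: "(b2, 0) \<in> carrier G"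
      using \<open>_ = (b2, 0)\<close> x h by (metis G.m_closed G.inv_closed)
    ultimately have k2: "(b2, 0) \<in> commutators #>\<^bsub>G\<^esub> (?a [^]\<^bsub>G\<^esub> k2)"
      using h D.rcos_module_rev G.is_group by blast
    have "(b1, 0) \<otimes>\<^bsub>G\<^esub> (b2, 0) = (b, 0)"
    proof -
      have "addB b1 b2 = b"
        using b2G insert.prems(1)
        by (intro base_eqI add_base b1) (auto simp: addB_def b1_def b2_def base_mod carrier_G)
      then show ?thesis using b2G by (simp add: mult_G carrier_G)
    qed
    with k1 k2 have "(b, 0) \<in> (commutators #>\<^bsub>G\<^esub> (?a [^]\<^bsub>G\<^esub> k1)) <#>\<^bsub>G\<^esub> (commutators #>\<^bsub>G\<^esub> (?a [^]\<^bsub>G\<^esub> k2))"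
      unfolding set_mult_def by (metis (mono_tags, lifting) UN_I singletonI)
    then show ?thesis
      using D.rcos_sum aG by (auto simp: G.nat_pow_mult)
  qed
qed

text \<open>For the harder inclusion, let b have augmentation 0 and write b = h a^k with h in G'. As
  h lies in the kernel, so does a^k; hence p divides k and b = h. Thus G' contains the augmentation
  ideal.\<close>

lemma subgroup_H_eq: "subgroup_H p d = ker_char"
proof
  interpret D: normal commutators G by (rule G.derived_self_is_normal)
  have ker: "subgroup ker_char G" by (rule char.subgroup_kernel)
  have "subgroup_Y p d \<subseteq> ker_char"
    by (auto simp: subgroup_Y_eq mem_ker_char)
  then show "subgroup_H p d \<subseteq> ker_char"
    using derived_subset_ker_char subgroup.m_closed[OF ker]
    unfolding subgroup_H_def set_mult_def by blast
  show "ker_char \<subseteq> subgroup_H p d"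
  proof
    fix g assume "g \<in> ker_char"
    then obtain b w where g: "g = (b, w)" "b \<in> base" "w \<in> L" "int p dvd pair (\<lambda>_. 1) b"
        "int p dvd poly_mapping.lookup w 1"
      by (cases g) (auto simp: mem_ker_char)
    obtain k :: nat where "(b, 0) \<in> commutators #>\<^bsub>G\<^esub> (gen_a p d [^]\<^bsub>G\<^esub> k)"
      using base_in_derived_coset[OF base_finite[OF g(2)] g(2)] by auto
    then obtain h where h: "h \<in> commutators" "(b, 0) = h \<otimes>\<^bsub>G\<^esub> (gen_a p d [^]\<^bsub>G\<^esub> k)"
      unfolding r_coset_def by auto
    have aG: "gen_a p d \<in> carrier G" by (simp add: gen_a_eq carrier_G)
    have b: "(b, 0) \<in> ker_char" using g by (simp add: mem_ker_char)
    have "gen_a p d [^]\<^bsub>G\<^esub> k = inv\<^bsub>G\<^esub> h \<otimes>\<^bsub>G\<^esub> (b, 0)"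
      using h(1) aG D.mem_carrier by (simp add: h(2) G.m_assoc[symmetric])
    then have "gen_a p d [^]\<^bsub>G\<^esub> k \<in> ker_char"
      using h(1) b derived_subset_ker_char ker by (auto intro: subgroup.m_closed subgroup.m_inv_closed)
    then have "int p dvd pair (\<lambda>_. 1) (\<lambda>w\<in>L. if w = 0 then int k mod int p else 0)"
      by (simp add: gen_a_pow mem_ker_char)
    also have "pair (\<lambda>_. 1) (\<lambda>w\<in>L. if w = 0 then int k mod int p else 0) = int k mod int p"
      by (subst pair_eq_sum[of "{0}"]) auto
    finally have "int k mod int p = 0" by (simp add: dvd_eq_mod_eq_0)
    then have "gen_a p d [^]\<^bsub>G\<^esub> k = \<one>\<^bsub>G\<^esub>"
      by (auto simp: gen_a_pow one_G zeroB_def fun_eq_iff)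
    then have "(b, 0) \<in> commutators"
      using h D.mem_carrier by simp
    moreover have "(zeroB, w) \<in> subgroup_Y p d"
      using g by (auto simp: subgroup_Y_eq)
    moreover have "g = (b, 0) \<otimes>\<^bsub>G\<^esub> (zeroB, w)"
      using g by (simp add: mult_G)
    ultimately show "g \<in> subgroup_H p d"
      unfolding subgroup_H_def set_mult_def by blast
  qed
qed

lemma subgroup_H_is_subgroup: "subgroup (subgroup_H p d) G"
  unfolding subgroup_H_eq by (rule char.subgroup_kernel)

lemma finite_rcosets_H: "finite (rcosets\<^bsub>G\<^esub> subgroup_H p d)"
proof -
  have "finite (carrier (G Mod ker_char))"
  proof (rule inj_on_finite[OF char.FactGroup_inj_on])
    show "(\<lambda>X. the_elem (char ` X)) ` carrier (G Mod ker_char) \<subseteq> carrier ZpZp"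
      by (rule hom_carrier[OF char.FactGroup_hom])
    show "finite (carrier ZpZp)"
      using p_gt_0 by (simp add: carrier_integer_mod_group)
  qed
  then show ?thesis by (simp add: FactGroup_def subgroup_H_eq)
qed

end

section \<open>The virtual endomorphism\<close>

context lamplighter
begin

section \<open>The isomorphism between Y and X and the cosets of Y, in exponent coordinates\<close>

definition vec :: "(nat \<Rightarrow> int) \<Rightarrow> nat \<Rightarrow>\<^sub>0 int"
  where "vec c = (\<Sum>j\<in>{1..d}. frag_cmul (c j) (frag_of j))"

lemma vec_L [simp, intro]: "vec c \<in> L"
  unfolding vec_def
  by (rule sum_closed_free_Abelian_group[of "{1..d}" _ "{1..d}", unfolded carrier_X]) simp

lemma lookup_vec: "j \<in> {1..d} \<Longrightarrow> poly_mapping.lookup (vec c) j = c j"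
  by (simp add: vec_def lookup_sum if_distrib cong: if_cong)

text \<open>The isomorphism \<sigma> from Y to X sends the j-th generator of Y to x_k with k =
  \<open>cyc j\<close>; the first generator of Y is x_1^p.\<close>

definition cyc :: "nat \<Rightarrow> nat"
  where "cyc j = (if j = d then 1 else Suc j)"

lemma bij_betw_cyc: "bij_betw cyc {1..d} {1..d}"
  by (rule bij_betwI[of _ _ _ "\<lambda>k. if k = 1 then d else k - 1"])
    (use d_ge_2 in \<open>auto simp: cyc_def\<close>)

lemma cyc_in: "j \<in> {1..d} \<Longrightarrow> cyc j \<in> {1..d}"
  using bij_betw_cyc by (auto simp: bij_betw_def)

lemma cyc_surj: "k \<in> {1..d} \<Longrightarrow> \<exists>j\<in>{1..d}. k = cyc j"
  using bij_betw_cyc by (auto simp: bij_betw_def)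

text \<open>The inverse of the isomorphism from \<open>Y\<close> to \<open>X\<close>.\<close>
definition rot :: "(nat \<Rightarrow>\<^sub>0 int) \<Rightarrow> nat \<Rightarrow>\<^sub>0 int"
  where "rot w = vec (\<lambda>j. (if j = 1 then int p else 1) * poly_mapping.lookup w (cyc j))"

text \<open>The exponent vector of x_1^i times the preimage of w under \<sigma>. The powers x_1^i
  with 0 <= i < p represent the cosets of Y in X.\<close>

definition glue :: "int \<Rightarrow> (nat \<Rightarrow>\<^sub>0 int) \<Rightarrow> nat \<Rightarrow>\<^sub>0 int"
  where "glue i w = frag_cmul i (frag_of 1) + rot w"

lemma one_in: "(1::nat) \<in> {1..d}"
  using d_ge_2 by auto

lemma rot_L [simp, intro]: "rot w \<in> L"
  by (simp add: rot_def)

lemma glue_L [simp, intro]: "glue i w \<in> L"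
  using one_in by (auto simp: glue_def)

lemma lookup_rot:
  "j \<in> {1..d} \<Longrightarrow>
    poly_mapping.lookup (rot w) j = (if j = 1 then int p else 1) * poly_mapping.lookup w (cyc j)"
  unfolding rot_def by (rule lookup_vec)

lemma lookup_glue:
  "j \<in> {1..d} \<Longrightarrow>
    poly_mapping.lookup (glue i w) j
      = (if j = 1 then i + int p * poly_mapping.lookup w (cyc 1) else poly_mapping.lookup w (cyc j))"
  by (simp add: glue_def lookup_add lookup_rot)

lemma rot_add: "rot (v + w) = rot v + rot w"
  by (rule exponents_eqI[of _ d]) (simp_all add: lookup_rot lookup_add distrib_left)

lemma rot_eqD:
  assumes "rot v = rot w" "v \<in> L" "w \<in> L"
  shows "v = w"
proof (rule exponents_eqI[OF assms(2,3)])
  fix k assume "k \<in> {1..d}"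
  then obtain j where j: "j \<in> {1..d}" "k = cyc j" using cyc_surj by blast
  show "poly_mapping.lookup v k = poly_mapping.lookup w k"
    using arg_cong[OF assms(1), of "\<lambda>x. poly_mapping.lookup x j"] j p_gt_0
    by (auto simp: lookup_rot split: if_splits)
qed

lemma inj_on_rot: "inj_on rot L"
  by (auto intro: inj_onI rot_eqD)

lemma glue_eqD:
  assumes "glue i v = glue k w" "i \<in> {0..<int p}" "k \<in> {0..<int p}" "v \<in> L" "w \<in> L"
  shows "i = k \<and> v = w"
proof -
  have "(i + int p * poly_mapping.lookup v (cyc 1)) mod int p
      = (k + int p * poly_mapping.lookup w (cyc 1)) mod int p"
    using arg_cong[OF assms(1), of "\<lambda>x. poly_mapping.lookup x 1"] one_in by (simp add: lookup_glue)
  then have "i = k" using assms(2,3) by simp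
  with assms show ?thesis by (auto simp: glue_def dest: rot_eqD)
qed

lemma glue_surj:
  assumes "v \<in> L"
  obtains i w where "i \<in> {0..<int p}" "w \<in> L" "v = glue i w" "i = poly_mapping.lookup v 1 mod int p"
proof -
  let ?i = "poly_mapping.lookup v 1 mod int p"
  \<comment> \<open>Division of the first coordinate by p leaves i as remainder; the quotient goes
    to position \<open>cyc 1\<close>, and the other coordinates are carried along by
    \<open>cyc\<close>.\<close>
  let ?w = "vec (\<lambda>k. if k = cyc 1 then poly_mapping.lookup v 1 div int p
      else poly_mapping.lookup v (inv_into {1..d} cyc k))"
  have inj: "inj_on cyc {1..d}" using bij_betw_cyc by (simp add: bij_betw_def)
  have eq: "v = glue ?i ?w"
  proof (rule exponents_eqI[OF assms glue_L])
    fix j assume j: "j \<in> {1..d}"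
    have "cyc j = cyc 1 \<longleftrightarrow> j = 1"
      using inj_onD[OF inj _ j one_in] by auto
    then have "poly_mapping.lookup ?w (cyc j)
        = (if j = 1 then poly_mapping.lookup v 1 div int p else poly_mapping.lookup v j)"
      unfolding lookup_vec[OF cyc_in[OF j]] using inv_into_f_f[OF inj j] by simp
    then show "poly_mapping.lookup v j = poly_mapping.lookup (glue ?i ?w) j"
      unfolding lookup_glue[OF j] by (cases "j = 1") simp_all
  qed
  show thesis
    by (rule that[OF _ vec_L eq refl]) (use p_gt_0 in simp)
qed

lemma glue_0: "glue 0 w = rot w"
  by (simp add: glue_def)

lemma mem_range_rot:
  assumes "v \<in> L" "int p dvd poly_mapping.lookup v 1"
  shows "v \<in> rot ` L"
proof -
  obtain i w where iw: "w \<in> L" "v = glue i w" and i: "i = poly_mapping.lookup v 1 mod int p"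
    using glue_surj[OF assms(1)] by metis
  from i assms(2) have "i = 0" by (simp only: dvd_eq_mod_eq_0)
  with iw show ?thesis by (simp add: glue_0)
qed

text \<open>
  Every lattice element is \<open>glue i w\<close> for a unique \<open>i < p\<close> and a unique \<open>w\<close>, so that an element of
  \<open>GF(p)[X]\<close> is \<open>\<Sum>\<^sub>i x\<^sub>1\<^sup>i r\<^sub>i\<close> with \<open>r\<^sub>i \<in> GF(p)[Y]\<close>; it is sent to \<open>\<Sum>\<^sub>i i \<sigma>(r\<^sub>i)\<close>, where
  \<open>\<sigma> = rot\<^sup>-\<^sup>1\<close>.
\<close>
definition contract :: "((nat \<Rightarrow>\<^sub>0 int) \<Rightarrow> int) \<Rightarrow> (nat \<Rightarrow>\<^sub>0 int) \<Rightarrow> int"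
  where "contract b = (\<lambda>w\<in>L. (\<Sum>i\<in>{0..<int p}. i * b (glue i w)) mod int p)"

text \<open>A finite set that contains the support of \<open>contract b\<close>, possibly properly
  because of the weights i and of cancellation. Its translates under \<open>glue i\<close> cover the
  whole support of b, as \<open>pair_contract\<close> requires.\<close>

definition shadow :: "((nat \<Rightarrow>\<^sub>0 int) \<Rightarrow> int) \<Rightarrow> (nat \<Rightarrow>\<^sub>0 int) set"
  where "shadow b = {w \<in> L. \<exists>i\<in>{0..<int p}. b (glue i w) \<noteq> 0}"

lemma finite_shadow:
  assumes "b \<in> base"
  shows "finite (shadow b)"
proof -
  have "shadow b = (\<Union>i\<in>{0..<int p}. glue i -` {w \<in> L. b w \<noteq> 0} \<inter> L)"
    by (auto simp: shadow_def)
  also have "finite \<dots>"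
    by (intro finite_UN_I finite_vimage_IntI base_finite assms)
      (auto intro!: inj_onI dest: glue_eqD)
  finally show ?thesis .
qed

lemma contract_not_shadow: "w \<in> L \<Longrightarrow> w \<notin> shadow b \<Longrightarrow> contract b w = 0"
  by (simp add: contract_def shadow_def)

lemma contract_base [simp, intro]:
  assumes "b \<in> base"
  shows "contract b \<in> base"
proof (rule baseI)
  show "finite (shadow b)" using assms by (rule finite_shadow)
qed (use p_gt_0 in \<open>simp_all add: contract_not_shadow\<close>, simp_all add: contract_def)

lemma contract_add: "contract (addB b c) = addB (contract b) (contract c)"
proof (rule ext)
  fix w
  have "[(\<Sum>i\<in>{0..<int p}. i * ((b (glue i w) + c (glue i w)) mod int p))
      = (\<Sum>i\<in>{0..<int p}. i * b (glue i w) + i * c (glue i w))] (mod int p)"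
    by (intro cong_sum) (simp add: cong_def mod_simps flip: distrib_left)
  then show "contract (addB b c) w = addB (contract b) (contract c) w"
    by (simp add: contract_def addB_def cong_def mod_simps sum.distrib)
qed

text \<open>Semilinearity over GF(p)[Y] with respect to \<sigma>; this makes \<open>endo\<close>
  multiplicative.\<close>

lemma contract_shift:
  assumes "u \<in> L"
  shows "contract (shift (rot u) b) = shift u (contract b)"
proof (rule ext)
  fix w
  have "glue i w + rot u = glue i (w + u)" for i
    by (simp add: glue_def rot_add)
  then show "contract (shift (rot u) b) w = shift u (contract b) w"
    using assms by (simp add: contract_def shift_def)
qed

text \<open>The subtracted monomial is \<open>glue 0 0\<close>, which has weight 0. With v = 0 this
  yields the prescribed value a^k, and with k = 0 the trivial value on Y.\<close>

lemma contract_delta_diff: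
  assumes "k \<in> {0..<int p}" "v \<in> L"
  shows "contract (addB (delta (glue k v)) (negB (delta 0))) = (\<lambda>w\<in>L. if w = v then k else 0)"
proof (rule ext)
  fix w
  have zero: "glue 0 0 = 0"
    by (rule exponents_eqI[of _ d]) (auto simp: lookup_glue)
  show "contract (addB (delta (glue k v)) (negB (delta 0))) w = (\<lambda>w\<in>L. if w = v then k else 0) w"
  proof (cases "w \<in> L")
    case w: True
    have 1: "glue i w = glue k v \<longleftrightarrow> i = k \<and> w = v" if "i \<in> {0..<int p}" for i
      using glue_eqD[of i w k v] that w assms by auto
    have 2: "glue i w = 0 \<longleftrightarrow> i = 0 \<and> w = 0" if "i \<in> {0..<int p}" for i
      using glue_eqD[of i w 0 0] that w p_gt_0 zero by auto
    have "[(\<Sum>i\<in>{0..<int p}. i * addB (delta (glue k v)) (negB (delta 0)) (glue i w))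
        = (\<Sum>i\<in>{0..<int p}. if i = k then i * of_bool (w = v) else 0)] (mod int p)"
    proof (rule cong_sum)
      fix i assume i: "i \<in> {0..<int p}"
      have "[i * addB (delta (glue k v)) (negB (delta 0)) (glue i w)
          = i * (delta (glue k v) (glue i w) - delta 0 (glue i w))] (mod int p)"
        by (simp add: addB_def negB_def cong_def mod_simps)
      also have "i * (delta (glue k v) (glue i w) - delta 0 (glue i w))
          = (if i = k then i * of_bool (w = v) else 0)"
        by (auto simp: delta_def 1[OF i] 2[OF i])
      finally show "[i * addB (delta (glue k v)) (negB (delta 0)) (glue i w)
          = (if i = k then i * of_bool (w = v) else 0)] (mod int p)" .
    qed
    also have "(\<Sum>i\<in>{0..<int p}. if i = k then i * of_bool (w = v) else 0) = (if w = v then k else 0)"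
      using assms(1) by simp
    finally show ?thesis
      using w assms(1) by (auto simp: contract_def cong_def)
  qed (simp add: contract_def)
qed

text \<open>The transpose of \<open>contract\<close>: \<psi> is the pullback of \<phi>. The
  congruence is asked for only on the support of b, because \<open>bin_glue\<close> holds only for
  nonnegative exponents.\<close>

lemma pair_contract:
  assumes b: "b \<in> base"
    and \<psi>: "\<And>i w. \<lbrakk>i \<in> {0..<int p}; w \<in> L; b (glue i w) \<noteq> 0\<rbrakk> \<Longrightarrow> [\<psi> (glue i w) = i * \<phi> w] (mod int p)"
  shows "[pair \<phi> (contract b) = pair \<psi> b] (mod int p)"
proof -
  let ?S = "shadow b" and ?I = "{0..<int p}"
  have S: "finite ?S" "?S \<subseteq> L" using finite_shadow[OF b] by (auto simp: shadow_def)
  have "pair \<phi> (contract b) = (\<Sum>w\<in>?S. \<phi> w * contract b w)"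
    using S contract_not_shadow by (intro pair_eq_sum) auto
  also have "[\<dots> = (\<Sum>w\<in>?S. \<Sum>i\<in>?I. \<psi> (glue i w) * b (glue i w))] (mod int p)"
  proof (rule cong_sum)
    fix w assume "w \<in> ?S"
    then have w: "w \<in> L" by (simp add: shadow_def)
    have "[\<phi> w * contract b w = \<phi> w * (\<Sum>i\<in>?I. i * b (glue i w))] (mod int p)"
      using w by (simp add: contract_def cong_def mod_simps)
    also have "\<phi> w * (\<Sum>i\<in>?I. i * b (glue i w)) = (\<Sum>i\<in>?I. (i * \<phi> w) * b (glue i w))"
      by (simp add: sum_distrib_left mult_ac)
    also have "[\<dots> = (\<Sum>i\<in>?I. \<psi> (glue i w) * b (glue i w))] (mod int p)"
    proof (rule cong_sum)
      fix i assume "i \<in> ?I"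
      then show "[i * \<phi> w * b (glue i w) = \<psi> (glue i w) * b (glue i w)] (mod int p)"
        using \<psi>[of i w] w by (cases "b (glue i w) = 0") (auto intro: cong_scalar_right cong_sym)
    qed
    finally show "[\<phi> w * contract b w = (\<Sum>i\<in>?I. \<psi> (glue i w) * b (glue i w))] (mod int p)" .
  qed
  also have "(\<Sum>w\<in>?S. \<Sum>i\<in>?I. \<psi> (glue i w) * b (glue i w))
      = (\<Sum>(i, w)\<in>?I \<times> ?S. \<psi> (glue i w) * b (glue i w))"
    by (subst sum.swap) (simp add: sum.cartesian_product)
  \<comment> \<open>Uniqueness of the decomposition \<open>glue i w\<close> turns the double sum
    into a sum over monomials.\<close>
  also have "\<dots> = (\<Sum>v\<in>(\<lambda>(i, w). glue i w) ` (?I \<times> ?S). \<psi> v * b v)"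
  proof (subst sum.reindex)
    show "inj_on (\<lambda>(i, w). glue i w) (?I \<times> ?S)"
      using S(2) by (auto intro!: inj_onI dest!: glue_eqD)
  qed (simp add: case_prod_unfold)
  also have "\<dots> = pair \<psi> b"
  proof (rule pair_eq_sum[symmetric])
    show "finite ((\<lambda>(i, w). glue i w) ` (?I \<times> ?S))" using S by simp
    fix v assume v: "v \<in> L" "v \<notin> (\<lambda>(i, w). glue i w) ` (?I \<times> ?S)"
    obtain i w where iw: "i \<in> ?I" "w \<in> L" "v = glue i w" using glue_surj[OF v(1)] by blast
    with v(2) have "w \<notin> ?S" by (auto simp: image_iff)
    with iw show "b v = 0" by (auto simp: shadow_def)
  qed auto
  finally show ?thesis .
qed

text \<open>On H the second component lies in the image of \<open>rot\<close>, where
  \<open>inv_into L rot\<close> is \<sigma>; values outside H are arbitrary.\<close>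

definition endo :: "lamplighter \<Rightarrow> lamplighter"
  where "endo = (\<lambda>(b, w). (contract b, inv_into L rot w))"

lemma endo_rot: "w \<in> L \<Longrightarrow> endo (b, rot w) = (contract b, w)"
  by (simp add: endo_def inj_on_rot)

lemma contract_zero [simp]: "contract zeroB = zeroB"
  by (auto simp: contract_def zeroB_def fun_eq_iff)

lemma rot_zero [simp]: "rot 0 = 0"
  by (rule exponents_eqI[of _ d]) (auto simp: lookup_rot)

lemma endo_base: "endo (b, 0) = (contract b, 0)"
  using endo_rot[of 0 b] by simp

lemma endo_hom: "endo \<in> hom (G\<lparr>carrier := subgroup_H p d\<rparr>) G"
proof (rule homI)
  have split: "\<exists>b w. g = (b, rot w) \<and> b \<in> base \<and> w \<in> L" if "g \<in> subgroup_H p d" for g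
    using that mem_range_rot by (cases g) (auto simp: subgroup_H_eq mem_ker_char)
  show "endo g \<in> carrier G" if "g \<in> carrier (G\<lparr>carrier := subgroup_H p d\<rparr>)" for g
    using split[of g] that by (auto simp: endo_rot carrier_G)
  fix g h assume gh: "g \<in> carrier (G\<lparr>carrier := subgroup_H p d\<rparr>)" "h \<in> carrier (G\<lparr>carrier := subgroup_H p d\<rparr>)"
  obtain b w c v where "g = (b, rot w)" "w \<in> L" "h = (c, rot v)" "v \<in> L"
    using split[of g] split[of h] gh by auto
  then show "endo (g \<otimes>\<^bsub>G\<lparr>carrier := subgroup_H p d\<rparr>\<^esub> h) = endo g \<otimes>\<^bsub>G\<^esub> endo h"
    by (simp add: mult_G rot_add[symmetric] endo_rot contract_add contract_shift)
qed

end

section \<open>Simplicity\<close>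

context lamplighter
begin

section \<open>Polynomials and their expansion at (1, ..., 1)\<close>

definition nonneg :: "(nat \<Rightarrow>\<^sub>0 int) \<Rightarrow> bool"
  where "nonneg w \<longleftrightarrow> (\<forall>j\<in>{1..d}. 0 \<le> poly_mapping.lookup w j)"

text \<open>Paired with a polynomial, this gives the coefficient of the product of the (x_j -
  1)^(e_j), a Hasse derivative at (1, ..., 1). Since \<open>nat\<close> truncates, it has this
  meaning only for monomials that satisfy \<open>nonneg\<close>.\<close>

definition bin :: "(nat \<Rightarrow> nat) \<Rightarrow> (nat \<Rightarrow>\<^sub>0 int) \<Rightarrow> int"
  where "bin e w = (\<Prod>j\<in>{1..d}. int (nat (poly_mapping.lookup w j) choose e j))"

text \<open>Pascal's rule in the k-th factor; all other factors agree and form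
  \<open>?P\<close>.\<close>

lemma bin_Suc:
  assumes "k \<in> {1..d}" "nonneg w"
  shows "bin (e(k := Suc (e k))) (w + frag_of k) = bin (e(k := Suc (e k))) w + bin e w"
proof -
  let ?P = "\<Prod>j\<in>{1..d} - {k}. int (nat (poly_mapping.lookup w j) choose e j)"
  have split: "bin f v = int (nat (poly_mapping.lookup v k) choose f k) * ?P"
    if "\<And>j. j \<noteq> k \<Longrightarrow> poly_mapping.lookup v j = poly_mapping.lookup w j \<and> f j = e j" for f v
  proof -
    have "(\<Prod>j\<in>{1..d} - {k}. int (nat (poly_mapping.lookup v j) choose f j)) = ?P"
      using that by (intro prod.cong) auto
    then show ?thesis
      unfolding bin_def using assms(1) by (subst prod.remove[of _ k]) auto
  qed
  have "nat (poly_mapping.lookup (w + frag_of k) k) = Suc (nat (poly_mapping.lookup w k))"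
    using assms by (simp add: nonneg_def lookup_add Suc_nat_eq_nat_zadd1)
  then show ?thesis
    by (simp add: split lookup_add algebra_simps)
qed

text \<open>The first coordinate of \<open>glue i w\<close> is p n + i with n the second coordinate
  of w, so Lucas' congruence yields i times \<open>n choose e 2\<close>. The other factors are those
  of \<open>bin e w\<close>, permuted by \<open>cyc\<close>.\<close>

lemma bin_glue:
  assumes "i \<in> {0..<int p}" "nonneg w"
  shows "[bin (\<lambda>j. if j = 1 then Suc (p * e 2) else if j = d then e 1 else e (Suc j)) (glue i w)
      = i * bin e w] (mod int p)"
proof -
  let ?e = "\<lambda>j. if j = 1 then Suc (p * e 2) else if j = d then e 1 else e (Suc j)"
  let ?g = "\<lambda>j. int (nat (poly_mapping.lookup w j) choose e j)"
  define n where "n = nat (poly_mapping.lookup w 2)"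
  have c1: "cyc 1 = 2" using d_ge_2 by (simp add: cyc_def)
  have nat: "nat (i + int p * poly_mapping.lookup w 2) = p * n + nat i"
    using assms d_ge_2 unfolding n_def nonneg_def
    by (simp add: nat_add_distrib nat_mult_distrib)
  have rest: "(\<Prod>j\<in>{1..d} - {1}. int (nat (poly_mapping.lookup (glue i w) j) choose ?e j))
      = (\<Prod>j\<in>{1..d} - {1}. ?g (cyc j))"
    by (intro prod.cong) (auto simp: lookup_glue cyc_def)
  have "bin ?e (glue i w) = int ((p * n + nat i) choose Suc (p * e 2)) * (\<Prod>j\<in>{1..d} - {1}. ?g (cyc j))"
    unfolding bin_def rest[symmetric] using one_in
    by (subst prod.remove[of _ 1]) (simp_all only: lookup_glue c1 nat simp_thms if_True finite_atLeastAtMost)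
  also have "[\<dots> = int (nat i * (n choose e 2)) * (\<Prod>j\<in>{1..d} - {1}. ?g (cyc j))] (mod int p)"
  proof (intro cong_scalar_right iffD2[OF cong_int_iff])
    show "[(p * n + nat i) choose Suc (p * e 2) = nat i * (n choose e 2)] (mod p)"
      using assms(1) by (intro choose_prime_mult_Suc_cong prime_p) (simp add: nat_less_iff)
  qed
  also have "int (nat i * (n choose e 2)) * (\<Prod>j\<in>{1..d} - {1}. ?g (cyc j))
      = i * (\<Prod>j\<in>{1..d}. ?g (cyc j))"
    using one_in assms(1) by (subst prod.remove[of "{1..d}" 1]) (simp_all only: c1 n_def, simp_all)
  also have "(\<Prod>j\<in>{1..d}. ?g (cyc j)) = bin e w"
    unfolding bin_def by (rule prod.reindex_bij_betw[OF bij_betw_cyc])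
  finally show ?thesis .
qed

text \<open>As i < p, a negative m would make i + p m negative. Consequently \<open>contract\<close>
  maps polynomials to polynomials.\<close>

lemma nonneg_glueD:
  assumes "nonneg (glue i w)" "i \<in> {0..<int p}"
  shows "nonneg w"
  unfolding nonneg_def
proof
  fix k assume "k \<in> {1..d}"
  then obtain j where j: "j \<in> {1..d}" "k = cyc j" using cyc_surj by blast
  have le: "0 \<le> poly_mapping.lookup (glue i w) j" using assms(1) j by (simp add: nonneg_def)
  have pos: "0 \<le> m" if "0 \<le> i + int p * m" for m
  proof (rule ccontr)
    assume "\<not> 0 \<le> m"
    then have "int p * m \<le> int p * (- 1)" using p_gt_0 by (intro mult_left_mono) auto
    with that assms(2) show False by simp
  qed
  show "0 \<le> poly_mapping.lookup w k"
    using le pos[of "poly_mapping.lookup w k"] unfolding lookup_glue[OF j(1)] j(2)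
    by (cases "j = 1") simp_all
qed

lemma pair_sum: "pair (\<lambda>w. \<phi> w + \<psi> w) b = pair \<phi> b + pair \<psi> b"
  by (simp add: pair_def sum.distrib distrib_right)

lemma pair_cong: "(\<And>w. \<lbrakk>w \<in> L; b w \<noteq> 0\<rbrakk> \<Longrightarrow> \<phi> w = \<psi> w) \<Longrightarrow> pair \<phi> b = pair \<psi> b"
  unfolding pair_def by (rule sum.cong) auto

text \<open>Otherwise an exponent \<open>e\<close> of maximal total degree in the support of \<open>b\<close> isolates the value of \<open>b\<close> at \<open>e\<close>.\<close>
lemma eq_zero_if_pair_bin:
  assumes b: "b \<in> base" and nonneg: "\<And>w. \<lbrakk>w \<in> L; b w \<noteq> 0\<rbrakk> \<Longrightarrow> nonneg w"
    and pair: "\<And>e. int p dvd pair (bin e) b"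
  shows "b = zeroB"
proof (rule ccontr)
  assume "b \<noteq> zeroB"
  let ?S = "{w \<in> L. b w \<noteq> 0}"
  let ?deg = "\<lambda>w. \<Sum>j\<in>{1..d}. poly_mapping.lookup w j"
  have "?S \<noteq> {}"
    using \<open>b \<noteq> zeroB\<close> base_eqI[OF b zero_base] by (auto simp: zeroB_def)
  then have "Max (?deg ` ?S) \<in> ?deg ` ?S"
    using base_finite[OF b] by (intro Max_in) auto
  then obtain w where w: "w \<in> ?S" "?deg w = Max (?deg ` ?S)"
    by (metis (no_types, lifting) imageE)
  have max: "?deg v \<le> ?deg w" if "v \<in> ?S" for v
    unfolding w(2) using base_finite[OF b] that by (intro Max_ge) auto
  let ?e = "\<lambda>j. nat (poly_mapping.lookup w j)"
  \<comment> \<open>A nonzero product of binomials forces v to dominate w in every coordinate;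
    maximality of the degree of w then gives v = w.\<close>
  have other: "bin ?e v = 0" if v: "v \<in> ?S" "v \<noteq> w" for v
  proof (rule ccontr)
    assume nz: "bin ?e v \<noteq> 0"
    have le: "poly_mapping.lookup w j \<le> poly_mapping.lookup v j" if j: "j \<in> {1..d}" for j
    proof -
      have "nat (poly_mapping.lookup v j) choose ?e j \<noteq> 0"
        using nz j unfolding bin_def by (auto simp: prod_zero_iff)
      then have "?e j \<le> nat (poly_mapping.lookup v j)"
        by (metis binomial_eq_0 not_le)
      moreover have "0 \<le> poly_mapping.lookup v j"
        using nonneg v j by (auto simp: nonneg_def)
      ultimately show ?thesis by linarith
    qed
    have "?deg w = ?deg v"
      using max[OF v(1)] le by (meson antisym sum_mono)
    then have "poly_mapping.lookup w j = poly_mapping.lookup v j" if "j \<in> {1..d}" for j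
      using sum_mono_inv[of _ "{1..d}"] le that by blast
    then have "w = v" using exponents_eqI[of w d v] w v by auto
    with v(2) show False by simp
  qed
  have "bin ?e w = 1" by (simp add: bin_def)
  moreover have "pair (bin ?e) b = (\<Sum>v\<in>?S. if v = w then bin ?e w * b w else 0)"
    unfolding pair_def using other by (intro sum.cong) auto
  ultimately have "pair (bin ?e) b = b w"
    using w base_finite[OF b] by simp
  then have "int p dvd b w" using pair[of ?e] by simp
  moreover have "0 \<le> b w" "b w < int p" "b w \<noteq> 0"
    using base_range[OF b] w by auto
  ultimately show False using zdvd_not_zless[of "b w" "int p"] by simp
qed

lemma invariant_eq_trivial:
  assumes K: "K \<lhd> G" "K \<subseteq> subgroup_H p d" "endo ` K \<subseteq> K"
  shows "K = {\<one>\<^bsub>G\<^esub>}"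
proof -
  interpret K: normal K G by fact
  \<comment> \<open>Normality makes the intersection of K with the base group an ideal of
    GF(p)[X].\<close>
  have conj: "(shift u b, 0) \<in> K" if "(b, 0) \<in> K" "u \<in> L" for u b
  proof -
    have "b \<in> base" using that(1) K.subset by (auto simp: carrier_G)
    then show ?thesis
      using K.inv_op_closed2[OF _ that(1), of "(zeroB, u)"] that(2)
      by (simp add: conj_top_base carrier_G)
  qed
  \<comment> \<open>The polynomials in this ideal; they are stable under multiplication by each x_k
    and under \<open>contract\<close>.\<close>
  define J where "J = {b \<in> base. (b, 0) \<in> K \<and> (\<forall>w\<in>L. b w \<noteq> 0 \<longrightarrow> nonneg w)}"
  define Q where "Q e \<longleftrightarrow> (\<forall>b\<in>J. int p dvd pair (bin e) b)" for e
  have "Q e" for e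
  proof (rule exponents_exhausted[of d p Q, OF d_ge_2])
    show "p > 0" using p_gt_0 by simp
    \<comment> \<open>For e = 0 the functional is the augmentation, which vanishes modulo p on
      H.\<close>
    show "Q (\<lambda>_. 0)"
      using K(2) unfolding Q_def J_def by (auto simp: bin_def[abs_def] subgroup_H_eq mem_ker_char)
    show "Q e'" if "Q e" "\<And>j. j \<in> {1..d} \<Longrightarrow> e' j = e j" for e e'
    proof -
      have "bin e' = bin e" unfolding bin_def using that(2) by (intro ext prod.cong) auto
      with that(1) show ?thesis by (simp add: Q_def)
    qed
    show "Q e" if Q: "Q (e(k := Suc (e k)))" and k: "k \<in> {1..d}" for e k
      unfolding Q_def
    proof
      fix b assume b: "b \<in> J"
      let ?E = "bin (e(k := Suc (e k)))"
      have bB: "b \<in> base" and bK: "(b, 0) \<in> K" and bN: "\<And>w. \<lbrakk>w \<in> L; b w \<noteq> 0\<rbrakk> \<Longrightarrow> nonneg w"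
        using b by (auto simp: J_def)
      \<comment> \<open>\<open>shift (- frag_of k)\<close> is multiplication by x_k and so maps J to
        itself. By Pascal's rule it changes the functional of the raised exponent by exactly the one
        for e.\<close>
      have u: "- frag_of k \<in> L" using k by simp
      have "nonneg w" if "w \<in> L" "shift (- frag_of k) b w \<noteq> 0" for w
      proof -
        have N: "nonneg (w + - frag_of k)"
          using that u by (intro bN) (auto simp: shift_def simp del: add_uminus_conv_diff)
        show ?thesis
          unfolding nonneg_def
        proof
          fix j assume "j \<in> {1..d}"
          with N have "0 \<le> poly_mapping.lookup (w + - frag_of k) j"
            unfolding nonneg_def by blast
          then show "0 \<le> poly_mapping.lookup w j"
            by (simp add: lookup_minus split: if_splits)
        qed
      qed
      then have "shift (- frag_of k) b \<in> J"
        using bB bK u conj by (simp add: J_def)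
      then have "int p dvd pair ?E (shift (- frag_of k) b)" "int p dvd pair ?E b"
        using Q b by (auto simp: Q_def)
      moreover have "pair ?E (shift (- frag_of k) b) = pair ?E b + pair (bin e) b"
        unfolding pair_shift[OF bB u] pair_sum[symmetric]
        using bin_Suc[OF k bN, of _ e] by (intro pair_cong) simp
      ultimately show "int p dvd pair (bin e) b"
        by (simp add: dvd_add_right_iff)
    qed
    show "Q (\<lambda>j. if j = 1 then Suc (p * e 2) else if j = d then e 1 else e (Suc j))" (is "Q ?e")
      if Q: "Q e" for e
      unfolding Q_def
    proof
      fix b assume b: "b \<in> J"
      then have bB: "b \<in> base" and bK: "(b, 0) \<in> K" and bN: "\<And>w. \<lbrakk>w \<in> L; b w \<noteq> 0\<rbrakk> \<Longrightarrow> nonneg w"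
        by (auto simp: J_def)
      have "(contract b, 0) \<in> K"
        using K(3) bK endo_base[of b] by (metis image_subset_iff)
      moreover have "nonneg w" if w: "w \<in> L" "contract b w \<noteq> 0" for w
      proof -
        obtain i where "i \<in> {0..<int p}" "b (glue i w) \<noteq> 0"
          using w contract_not_shadow[of w b] unfolding shadow_def by blast
        then show ?thesis using bN nonneg_glueD by blast
      qed
      ultimately have "contract b \<in> J" using bB by (simp add: J_def)
      then have "int p dvd pair (bin e) (contract b)" using Q by (simp add: Q_def)
      moreover have "[pair (bin e) (contract b) = pair (bin ?e) b] (mod int p)"
        using bN nonneg_glueD by (intro pair_contract[OF bB] bin_glue) blast+
      ultimately show "int p dvd pair (bin ?e) b"
        by (simp only: cong_dvd_iff)
    qed
  qed
  then have J: "b = zeroB" if "b \<in> J" for b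
    using that by (intro eq_zero_if_pair_bin) (auto simp: Q_def J_def)
  have zero: "b = zeroB" if bK: "(b, 0) \<in> K" for b
  proof -
    have bB: "b \<in> base" using that K.subset by (auto simp: carrier_G)
    let ?S = "{w \<in> L. b w \<noteq> 0}"
    \<comment> \<open>N bounds all coordinates of the support in absolute value, so multiplication
      by (x_1 ... x_d)^N turns b into a polynomial; the opposite shift undoes it.\<close>
    define N where "N = (\<Sum>w\<in>?S. \<Sum>j\<in>{1..d}. \<bar>poly_mapping.lookup w j\<bar>)"
    define u where "u = vec (\<lambda>_. N)"
    have uL: "- u \<in> L" by (simp add: u_def)
    have N: "\<bar>poly_mapping.lookup w j\<bar> \<le> N" if "w \<in> ?S" "j \<in> {1..d}" for w j
    proof -
      have "\<bar>poly_mapping.lookup w j\<bar> \<le> (\<Sum>j\<in>{1..d}. \<bar>poly_mapping.lookup w j\<bar>)"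
        using that(2) by (intro member_le_sum) auto
      also have "\<dots> \<le> N"
        unfolding N_def using that(1) base_finite[OF bB]
        by (intro member_le_sum[of w ?S "\<lambda>w. \<Sum>j\<in>{1..d}. \<bar>poly_mapping.lookup w j\<bar>"])
          (auto intro: sum_nonneg)
      finally show ?thesis .
    qed
    have "nonneg w" if "w \<in> L" "shift (- u) b w \<noteq> 0" for w
      unfolding nonneg_def
    proof
      fix j assume j: "j \<in> {1..d}"
      have "w + - u \<in> ?S" using that uL by (auto simp: shift_def simp del: add_uminus_conv_diff)
      then have "\<bar>poly_mapping.lookup (w + - u) j\<bar> \<le> N" using N j by blast
      then show "0 \<le> poly_mapping.lookup w j"
        using j by (simp add: lookup_minus u_def lookup_vec)
    qed
    then have "shift (- u) b = zeroB"
      using bB bK uL conj by (intro J) (simp add: J_def)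
    moreover have "b = shift u (shift (- u) b)"
      using bB uL vec_L[of "\<lambda>_. N"] unfolding u_def[symmetric]
      by (intro base_eqI shift_base) (auto simp: shift_def)
    ultimately show ?thesis by (simp add: u_def)
  qed
  have "g = \<one>\<^bsub>G\<^esub>" if gK: "g \<in> K" for g
  proof -
    have a: "gen_a p d \<in> carrier G" by (simp add: gen_a_eq carrier_G)
    obtain b w where g: "g = (b, w)" "b \<in> base" "w \<in> L"
      using gK K.subset by (cases g) (auto simp: carrier_G)
    have gG: "g \<in> carrier G" using that by simp
    \<comment> \<open>The commutator of g with a lies in K and in the base group, so it is trivial
      by the case already settled.\<close>
    have "g \<otimes>\<^bsub>G\<^esub> (gen_a p d \<otimes>\<^bsub>G\<^esub> inv\<^bsub>G\<^esub> g \<otimes>\<^bsub>G\<^esub> inv\<^bsub>G\<^esub> (gen_a p d)) \<in> K"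
      using gK by (intro K.m_closed K.inv_op_closed2 a) auto
    also have "g \<otimes>\<^bsub>G\<^esub> (gen_a p d \<otimes>\<^bsub>G\<^esub> inv\<^bsub>G\<^esub> g \<otimes>\<^bsub>G\<^esub> inv\<^bsub>G\<^esub> (gen_a p d))
        = (g \<otimes>\<^bsub>G\<^esub> gen_a p d \<otimes>\<^bsub>G\<^esub> inv\<^bsub>G\<^esub> g) \<otimes>\<^bsub>G\<^esub> inv\<^bsub>G\<^esub> (gen_a p d)"
      using gG a by (simp add: G.m_assoc)
    also have "g \<otimes>\<^bsub>G\<^esub> gen_a p d \<otimes>\<^bsub>G\<^esub> inv\<^bsub>G\<^esub> g = (delta (- w), 0)"
    proof -
      have "(delta (- w), 0) \<otimes>\<^bsub>G\<^esub> g = g \<otimes>\<^bsub>G\<^esub> gen_a p d"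
        using g by (simp add: mult_G gen_a_eq shift_delta addB_def add.commute)
      moreover have "(delta (- w), 0) \<in> carrier G" by (simp add: carrier_G)
      ultimately show ?thesis using gG a by (metis G.inv_solve_right G.m_closed)
    qed
    finally have "addB (delta (- w)) (negB (delta 0)) = zeroB"
      by (intro zero) (simp add: gen_a_eq inv_base mult_G)
    then have "addB (delta (- w)) (negB (delta 0)) 0 = 0"
      by (simp add: zeroB_def)
    \<comment> \<open>For nonzero w the coefficient of the commutator at 0 would be -1 modulo p.
      With w = 0, g itself lies in the base group.\<close>
    then have "w = 0"
      using p_gt_1 by (cases "w = 0") (simp_all add: addB_def negB_def delta_def zmod_minus1)
    then show ?thesis
      using that zero g by (simp add: one_G)
  qed
  then show ?thesis using K.one_closed by auto
qed

lemma endo_simple: "simple_virtual_endomorphism G (subgroup_H p d) endo"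
  unfolding simple_virtual_endomorphism_def virtual_endomorphism_def
  using subgroup_H_is_subgroup finite_rcosets_H endo_hom invariant_eq_trivial by blast

section \<open>Prescribed values on the generators\<close>

lemma endo_gen_a_x:
  assumes "i \<in> {1..p - 1}"
  shows "endo (pow_minus_one G (gen_a p d) (gen_x p d 1 [^]\<^bsub>G\<^esub> i)) = gen_a p d [^]\<^bsub>G\<^esub> i"
proof -
  have i: "int i \<in> {0..<int p}" "int i mod int p = int i" using assms by auto
  have "frag_cmul (int i) (frag_of 1) = glue (int i) 0" by (simp add: glue_def)
  then show ?thesis
    using contract_delta_diff[OF i(1), of 0] one_in i(2)
    by (auto simp: gen_x_eq top_pow pow_minus_one_top endo_base gen_a_pow fun_eq_iff)
qed

lemma endo_gen_a_Y:
  assumes "z \<in> subgroup_Y p d"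
  shows "endo (pow_minus_one G (gen_a p d) z) = \<one>\<^bsub>G\<^esub>"
proof -
  obtain w where w: "z = (zeroB, w)" "w \<in> L" "int p dvd poly_mapping.lookup w 1"
    using assms by (auto simp: subgroup_Y_eq)
  obtain v where "v \<in> L" "w = glue 0 v"
    using mem_range_rot[OF w(2,3)] by (auto simp: glue_0)
  then have "contract (addB (delta w) (negB (delta 0))) = zeroB"
    using contract_delta_diff[of 0 v] p_gt_0 by (auto simp: zeroB_def fun_eq_iff)
  then show ?thesis
    using w by (simp add: pow_minus_one_top endo_base one_G)
qed

lemma endo_top: "v \<in> L \<Longrightarrow> w = rot v \<Longrightarrow> endo (zeroB, w) = (zeroB, v)"
  by (simp add: endo_rot)

lemma endo_gen_x1: "endo (gen_x p d 1 [^]\<^bsub>G\<^esub> p) = gen_x p d 2"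
proof -
  have "endo (zeroB, frag_cmul (int p) (frag_of 1)) = (zeroB, frag_of 2)"
    using d_ge_2 one_in
    by (intro endo_top exponents_eqI[of _ d]) (auto simp: lookup_rot cyc_def)
  then show ?thesis using one_in by (simp add: gen_x_eq top_pow)
qed

lemma endo_gen_x:
  assumes "j \<in> {2..d}"
  shows "endo (gen_x p d j) = gen_x p d (if j = d then 1 else 1 + j)"
  using assms unfolding gen_x_eq
  by (intro endo_top exponents_eqI[of _ d]) (auto simp: lookup_rot cyc_def)

end

theorem theorem4:
  fixes p d :: nat
  assumes "prime p" and "d \<ge> 2"
  shows "let G = lamplighter_group p d; H = subgroup_H p d; Y = subgroup_Y p d;
             a = gen_a p d; x = gen_x p d
         in \<exists>f. simple_virtual_endomorphism G H f
              \<and> (\<forall>i\<in>{1..p - 1}. f (pow_minus_one G a (x 1 [^]\<^bsub>G\<^esub> i)) = a [^]\<^bsub>G\<^esub> i)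
              \<and> (\<forall>z\<in>Y. f (pow_minus_one G a z) = \<one>\<^bsub>G\<^esub>)
              \<and> f (x 1 [^]\<^bsub>G\<^esub> p) = x 2
              \<and> (\<forall>j\<in>{2..d - 1}. f (x j) = x (1 + j))
              \<and> f (x d) = x 1"
proof -
  interpret lamplighter p d
    using assms by unfold_locales
  have "endo (gen_x p d j) = gen_x p d (1 + j)" if "j \<in> {2..d - 1}" for j
    using endo_gen_x[of j] that by auto
  moreover have "endo (gen_x p d d) = gen_x p d 1"
    using endo_gen_x[of d] d_ge_2 by simp
  ultimately show ?thesis
    unfolding Let_def using endo_simple endo_gen_a_x endo_gen_a_Y endo_gen_x1
    by (intro exI[of _ endo]) blast
qed

end
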